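(* For every non-zero, bounded $\tau$-smooth measure $\mu$ on a coherent topological space $X$, the map $\widetilde\mu:\mathcal L^{\mathbf I\mathbb R_+^\star}X\to\mathbf I\mathbb R_+^\star$, $\widetilde\mu(h)=\left[\int_{x\in X}^- h^-(x)\,d\mu,\ \int_{x\in X}^+ h^+(x)\,d\mu\right]$, is a continuous $\mathbf I\mathbb R_+^\star$-valuation.
   Context: $\overline{\mathbb R}_+=[0,+\infty]$. $\mathbf I\mathbb R_+^\star$ is the dcpo of closed intervals $[a,b]$ with $0\le a\le b\le+\infty$, ordered by reverse inclusion, with its Scott topology. It carries $0=[0,0]$, $1=[1,1]$, $[a,b]+[c,d]=[a+c,b+d]$, $[a,b]\times[c,d]=[a\cdot_\ell c,\ b\cdot_r d]$, where $\cdot_\ell$ and $\cdot_r$ are the usual product except that $0\cdot_\ell(+\infty)=(+\infty)\cdot_\ell 0=0$ and $0\cdot_r(+\infty)=(+\infty)\cdot_r 0=+\infty$. For a topological space $X$, $\mathcal L^{\mathbf I\mathbb R_+^\star}X$ is the dcpo of continuous maps $h:X\to\mathbf I\mathbb R_+^\star$, ordered pointwise, with pointwise $+$ and $\times$; write $h(x)=[h^-(x),h^+(x)]$; then $h^-$ is lower semicontinuous and $h^+$ is upper semicontinuous. A continuous $\mathbf I\mathbb R_+^\star$-valuation on $X$ is a Scott-continuous map $\nu:\mathcal L^{\mathbf I\mathbb R_+^\star}X\to\mathbf I\mathbb R_+^\star$ with $\nu(\mathbf a\times h)=\mathbf a\times\nu(h)$ and $\nu(h+h')=\nu(h)+\nu(h')$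 for all $\mathbf a\in\mathbf I\mathbb R_+^\star$ and all $h,h'$. Measures on $X$ are $\overline{\mathbb R}_+$-valued measures on the Borel $\sigma$-algebra. $\mu$ is bounded if $\mu(X)<\infty$, non-zero if $\mu(X)\ne 0$, and $\tau$-smooth if its restriction to open sets is Scott-continuous, i.e. $\mu(\bigcup_i U_i)=\sup_i\mu(U_i)$ for every directed family of open sets. A space is coherent if the intersection of any two compact saturated subsets is compact (a set is saturated if it is an intersection of open sets). Lower integral of a measurable $f:X\to\overline{\mathbb R}_+$: $\int_{x\in X}^- f(x)\,d\mu=\sup_{r\in\mathbb R_+}\int_{x\in X}\min(f(x),r)\,d\mu$ (Lebesgue integrals on the right). A support of $\mu$ is a set $E\subseteq X$ such that for all measurable $A,B$ with $A\cap E=B\cap E$, $\mu(A)=\mu(B)$. For $\tau$-smooth $\mu$, $\operatorname{supp}\mu$ is the smallest closed support of $\mu$ (the intersection of all closed supports; equivalently the complement of the largest open set of $\mu$-measure $0$). A measurable $f:X\to\overline{\mathbb R}_+$ is $\mu$-bounded if there is a measurable compact saturated support $Q$ of $\mu$ with $\sup_{x\in Q\cap\operatorname{supp}\mu}f(x)<\infty$. For upper semicontinuous $f:X\to\overline{\mathbb R}_+$ (i.e. $f^{-1}([0,r[)$ is open for all $r>0$), the upper integral $\int_{x\in X}^+ f(x)\,d\mu$ is $\int_{x\in X}^- f(x)\,d\mu$ if $f$ is $\mu$-bounded, and $\infty$ otherwise. *)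

theory Defs
  imports "HOL-Analysis.Analysis"
begin

section \<open>Directed suprema and Scott continuity\<close>

definition directed :: "'p::order set \<Rightarrow> bool" where
  "directed D \<longleftrightarrow> D \<noteq> {} \<and> (\<forall>x\<in>D. \<forall>y\<in>D. \<exists>z\<in>D. x \<le> z \<and> y \<le> z)"

(* Suprema are taken in the sub-poset A, because the poset of continuous maps is
   represented as a subset of a full function type. *)
definition is_lub_on :: "'p::order set \<Rightarrow> 'p set \<Rightarrow> 'p \<Rightarrow> bool" where
  "is_lub_on A D s \<longleftrightarrow>
     s \<in> A \<and> (\<forall>d\<in>D. d \<le> s) \<and> (\<forall>u\<in>A. (\<forall>d\<in>D. d \<le> u) \<longrightarrow> s \<le> u)"

definition scott_open :: "'p::order set \<Rightarrow> bool" where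
  "scott_open U \<longleftrightarrow>
     (\<forall>x\<in>U. \<forall>y. x \<le> y \<longrightarrow> y \<in> U) \<and>
     (\<forall>D s. directed D \<and> is_lub_on UNIV D s \<and> s \<in> U \<longrightarrow> D \<inter> U \<noteq> {})"

definition scott_continuous_on :: "'p::order set \<Rightarrow> ('p \<Rightarrow> 'q::order) \<Rightarrow> bool" where
  "scott_continuous_on A f \<longleftrightarrow>
     mono_on A f \<and>
     (\<forall>D s. D \<subseteq> A \<and> directed D \<and> is_lub_on A D s \<longrightarrow> is_lub_on UNIV (f ` D) (f s))"

lemma scott_open_UNIV: "scott_open UNIV"
  by (simp add: scott_open_def directed_def)

lemma scott_openI:
  assumes "\<And>x y. x \<in> U \<Longrightarrow> x \<le> y \<Longrightarrow> y \<in> U"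
    and "\<And>D s. directed D \<Longrightarrow> is_lub_on UNIV D s \<Longrightarrow> s \<in> U \<Longrightarrow> D \<inter> U \<noteq> {}"
  shows "scott_open U"
  unfolding scott_open_def using assms by metis

lemma scott_open_up: "scott_open U \<Longrightarrow> x \<in> U \<Longrightarrow> x \<le> y \<Longrightarrow> y \<in> U"
  by (simp add: scott_open_def)

lemma scott_open_meets:
  "scott_open U \<Longrightarrow> directed D \<Longrightarrow> is_lub_on UNIV D s \<Longrightarrow> s \<in> U \<Longrightarrow> D \<inter> U \<noteq> {}"
  unfolding scott_open_def by metis

lemma directedE:
  assumes "directed D" "x \<in> D" "y \<in> D"
  obtains z where "z \<in> D" "x \<le> z" "y \<le> z"
  using assms unfolding directed_def by metis

lemma scott_open_Int:
  assumes U: "scott_open U" and V: "scott_open V"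
  shows "scott_open (U \<inter> V)"
proof (rule scott_openI)
  fix x y assume "x \<in> U \<inter> V" "x \<le> y"
  then show "y \<in> U \<inter> V" using scott_open_up[OF U] scott_open_up[OF V] by blast
next
  fix D s assume D: "directed D" and s: "is_lub_on UNIV D s" "s \<in> U \<inter> V"
  have "D \<inter> U \<noteq> {}" "D \<inter> V \<noteq> {}"
    using scott_open_meets[OF U D s(1)] scott_open_meets[OF V D s(1)] s(2) by simp_all
  then obtain d e where de: "d \<in> D" "d \<in> U" "e \<in> D" "e \<in> V" by blast
  obtain z where z: "z \<in> D" "d \<le> z" "e \<le> z" by (rule directedE[OF D de(1,3)])
  from z(1) scott_open_up[OF U de(2) z(2)] scott_open_up[OF V de(4) z(3)]
  show "D \<inter> (U \<inter> V) \<noteq> {}" by blast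
qed

lemma scott_open_Union:
  assumes "\<forall>U\<in>\<U>. scott_open U" shows "scott_open (\<Union>\<U>)"
proof (rule scott_openI)
  fix x y assume "x \<in> \<Union>\<U>" "x \<le> y"
  then obtain U where "U \<in> \<U>" "x \<in> U" by blast
  with assms \<open>x \<le> y\<close> show "y \<in> \<Union>\<U>" by (meson UnionI scott_open_up)
next
  fix D s assume D: "directed D" and s: "is_lub_on UNIV D s" "s \<in> \<Union>\<U>"
  then obtain U where U: "U \<in> \<U>" "s \<in> U" by blast
  with assms have "D \<inter> U \<noteq> {}" by (meson scott_open_meets D s(1))
  with U show "D \<inter> \<Union>\<U> \<noteq> {}" by blast
qed

section \<open>The interval domain\<close>

(* The type interval of HOL-Library.Interval is not used: its order, its product and its
   topology are not the ones of the interval domain. *)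
typedef ival = "{(a :: ennreal, b :: ennreal). a \<le> b}"
  by auto

setup_lifting type_definition_ival

lift_definition ilower :: "ival \<Rightarrow> ennreal" is fst .
lift_definition iupper :: "ival \<Rightarrow> ennreal" is snd .

lemma ilower_le_iupper: "ilower x \<le> iupper x"
  by transfer auto

lemma ival_eq_iff: "x = y \<longleftrightarrow> ilower x = ilower y \<and> iupper x = iupper y"
  by transfer auto

(* x * 0 = 0 for all x :: ennreal, so the product of ennreal is the lower one. *)
definition times_upper :: "ennreal \<Rightarrow> ennreal \<Rightarrow> ennreal" where
  "times_upper b d =
     (if (b = 0 \<and> d = \<infinity>) \<or> (b = \<infinity> \<and> d = 0) then \<infinity> else b * d)"

lemma times_le_times_upper:
  assumes "a \<le> b" "c \<le> d" shows "a * c \<le> times_upper b d"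
  using assms by (auto simp: times_upper_def intro: mult_mono)

instantiation ival :: "{zero, one, plus, times}"
begin

lift_definition zero_ival :: ival is "(0, 0)" by simp

lift_definition one_ival :: ival is "(1, 1)" by simp

lift_definition plus_ival :: "ival \<Rightarrow> ival \<Rightarrow> ival"
  is "\<lambda>(a, b) (c, d). (a + c, b + d)"
  by (auto intro: add_mono)

lift_definition times_ival :: "ival \<Rightarrow> ival \<Rightarrow> ival"
  is "\<lambda>(a, b) (c, d). (a * c, times_upper b d)"
  by (auto intro: times_le_times_upper)

instance ..

end

instantiation ival :: order
begin

definition less_eq_ival :: "ival \<Rightarrow> ival \<Rightarrow> bool" where
  "x \<le> y \<longleftrightarrow> {ilower y..iupper y} \<subseteq> {ilower x..iupper x}"

definition less_ival :: "ival \<Rightarrow> ival \<Rightarrow> bool" where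
  "x < y \<longleftrightarrow> x \<le> y \<and> \<not> y \<le> (x::ival)"

instance
proof
  fix x y z :: ival
  show "x < y \<longleftrightarrow> x \<le> y \<and> \<not> y \<le> x" by (rule less_ival_def)
  show "x \<le> x" by (simp add: less_eq_ival_def)
  show "x \<le> y \<Longrightarrow> y \<le> z \<Longrightarrow> x \<le> z" unfolding less_eq_ival_def by blast
  show "x \<le> y \<Longrightarrow> y \<le> x \<Longrightarrow> x = y"
    using ilower_le_iupper[of x] ilower_le_iupper[of y]
    by (auto simp: less_eq_ival_def ival_eq_iff)
qed

end

lemma less_eq_ival_iff: "x \<le> y \<longleftrightarrow> ilower x \<le> ilower y \<and> iupper y \<le> iupper x"
  using ilower_le_iupper[of y] by (auto simp: less_eq_ival_def)

instantiation ival :: topological_space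
begin

definition open_ival :: "ival set \<Rightarrow> bool" where
  "open_ival = scott_open"

instance
  by standard (simp_all add: open_ival_def scott_open_UNIV scott_open_Int scott_open_Union)

end

lemma ilower_Abs_ival: "a \<le> b \<Longrightarrow> ilower (Abs_ival (a, b)) = a"
  and iupper_Abs_ival: "a \<le> b \<Longrightarrow> iupper (Abs_ival (a, b)) = b"
  by (simp_all add: ilower.rep_eq iupper.rep_eq Abs_ival_inverse)

lemma is_lub_on_ival:
  assumes "directed D"
  shows "is_lub_on UNIV D (Abs_ival (SUP d\<in>D. ilower d, INF d\<in>D. iupper d))"
proof -
  have "(SUP d\<in>D. ilower d) \<le> (INF d\<in>D. iupper d)"
  proof (intro SUP_least INF_greatest)
    fix d e assume "d \<in> D" "e \<in> D"
    with assms obtain z where "d \<le> z" "e \<le> z" by (rule directedE)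
    then have "ilower d \<le> ilower z" "iupper z \<le> iupper e" by (simp_all add: less_eq_ival_iff)
    with ilower_le_iupper[of z] show "ilower d \<le> iupper e" by (meson order_trans)
  qed
  note ilower_Abs_ival[OF this, simp] iupper_Abs_ival[OF this, simp]
  show ?thesis
    unfolding is_lub_on_def less_eq_ival_iff
    by (simp add: SUP_upper INF_lower SUP_le_iff le_INF_iff)
qed

section \<open>Continuous interval valuations\<close>

definition cont_maps :: "('a::topological_space \<Rightarrow> ival) set" where
  "cont_maps = {h. continuous_on UNIV h}"

definition continuous_ival_valuation ::
    "(('a::topological_space \<Rightarrow> ival) \<Rightarrow> ival) \<Rightarrow> bool" where
  "continuous_ival_valuation \<nu> \<longleftrightarrow>
     scott_continuous_on cont_maps \<nu> \<and>
     (\<forall>a. \<forall>h\<in>cont_maps. \<nu> (\<lambda>x. a * h x) = a * \<nu> h) \<and>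
     (\<forall>h\<in>cont_maps. \<forall>h'\<in>cont_maps. \<nu> (\<lambda>x. h x + h' x) = \<nu> h + \<nu> h')"

section \<open>Coherence, tau-smoothness and supports\<close>

definition saturated :: "'a::topological_space set \<Rightarrow> bool" where
  "saturated Q \<longleftrightarrow> (\<exists>\<U>. (\<forall>U\<in>\<U>. open U) \<and> Q = \<Inter>\<U>)"

definition coherent_space :: "'a::topological_space itself \<Rightarrow> bool" where
  "coherent_space _ \<longleftrightarrow>
     (\<forall>Q Q' :: 'a set. compact Q \<and> saturated Q \<and> compact Q' \<and> saturated Q'
        \<longrightarrow> compact (Q \<inter> Q'))"

definition tau_smooth :: "'a::topological_space measure \<Rightarrow> bool" where
  "tau_smooth \<mu> \<longleftrightarrow>
     (\<forall>\<U>. (\<forall>U\<in>\<U>. open U) \<and> directed \<U>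
        \<longrightarrow> emeasure \<mu> (\<Union>\<U>) = (SUP U\<in>\<U>. emeasure \<mu> U))"

(* A support need not be measurable. *)
definition is_support :: "'a measure \<Rightarrow> 'a set \<Rightarrow> bool" where
  "is_support \<mu> E \<longleftrightarrow>
     (\<forall>A\<in>sets \<mu>. \<forall>B\<in>sets \<mu>. A \<inter> E = B \<inter> E \<longrightarrow> emeasure \<mu> A = emeasure \<mu> B)"

definition supp :: "'a::topological_space measure \<Rightarrow> 'a set" where
  "supp \<mu> = \<Inter>{E. closed E \<and> is_support \<mu> E}"

section \<open>Lower and upper integrals\<close>

definition lower_integral :: "'a measure \<Rightarrow> ('a \<Rightarrow> ennreal) \<Rightarrow> ennreal" where
  "lower_integral \<mu> f = (SUP r\<in>{0::real..}. \<integral>\<^sup>+ x. min (f x) (ennreal r) \<partial>\<mu>)"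

definition bounded_wrt :: "'a::topological_space measure \<Rightarrow> ('a \<Rightarrow> ennreal) \<Rightarrow> bool" where
  "bounded_wrt \<mu> f \<longleftrightarrow>
     (\<exists>Q\<in>sets \<mu>. compact Q \<and> saturated Q \<and> is_support \<mu> Q \<and>
        (SUP x\<in>Q \<inter> supp \<mu>. f x) < \<infinity>)"

definition upper_integral :: "'a::topological_space measure \<Rightarrow> ('a \<Rightarrow> ennreal) \<Rightarrow> ennreal" where
  "upper_integral \<mu> f = (if bounded_wrt \<mu> f then lower_integral \<mu> f else \<infinity>)"

definition ival_integral ::
    "'a::topological_space measure \<Rightarrow> ('a \<Rightarrow> ival) \<Rightarrow> ival" where
  "ival_integral \<mu> h =
     Abs_ival (lower_integral \<mu> (\<lambda>x. ilower (h x)), upper_integral \<mu> (\<lambda>x. iupper (h x)))"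

(* The pair in ival_integral_def always represents an interval. *)
lemma ilower_ival_integral:
    "ilower (ival_integral \<mu> h) = lower_integral \<mu> (\<lambda>x. ilower (h x))" (is ?lo)
  and iupper_ival_integral:
    "iupper (ival_integral \<mu> h) = upper_integral \<mu> (\<lambda>x. iupper (h x))" (is ?up)
proof -
  have "lower_integral \<mu> (\<lambda>x. ilower (h x)) \<le> lower_integral \<mu> (\<lambda>x. iupper (h x))"
    unfolding lower_integral_def
    by (rule SUP_mono', rule nn_integral_mono, rule min.mono, rule ilower_le_iupper, rule order_refl)
  then have "lower_integral \<mu> (\<lambda>x. ilower (h x)) \<le> upper_integral \<mu> (\<lambda>x. iupper (h x))"
    by (simp add: upper_integral_def)
  then show ?lo ?up
    by (simp_all add: ival_integral_def ilower_Abs_ival iupper_Abs_ival)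
qed

end

theory Submission
  imports Defs
begin

text \<open>By coherence, the compact saturated supports of \<open>\<mu>\<close> are closed under binary
  intersection, so a sum is \<open>\<mu>\<close>-bounded iff both summands are. If \<open>Q\<close> is a compact support,
  \<open>Q \<inter> supp \<mu>\<close> is compact and conull; hence an upper semicontinuous function that is finite
  on it is bounded on it, and if a directed infimum of upper semicontinuous functions is bounded
  on it, so is some member of the family. Finally, \<open>\<tau>\<close>-smoothness and finiteness of \<open>\<mu>\<close> reduce
  a directed family of semicontinuous functions, up to null sets, to a monotone sequence, to which
  the monotone convergence theorems apply.\<close>

section \<open>Continuous interval-valued maps\<close>

lemma is_lub_on_unique: "is_lub_on A D s \<Longrightarrow> is_lub_on A D t \<Longrightarrow> s = t"
  unfolding is_lub_on_def by (blast intro: order.antisym)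

lemma directed_image_mono:
  assumes "directed D" "\<And>x y. x \<in> D \<Longrightarrow> y \<in> D \<Longrightarrow> x \<le> y \<Longrightarrow> f x \<le> f y"
  shows "directed (f ` D)"
  using assms unfolding directed_def by (auto; blast)

text \<open>Suprema are unique, so \<open>s\<close> is the explicit interval of
  \<open>is_lub_on_ival\<close>; that its two ends are in the right order is read off from
  \<open>s\<close> being an upper bound.\<close>

lemma is_lub_on_ival_bounds:
  assumes "directed D" "is_lub_on UNIV D s"
  shows "ilower s = (SUP d\<in>D. ilower d)" and "iupper s = (INF d\<in>D. iupper d)"
proof -
  let ?a = "SUP d\<in>D. ilower d" and ?b = "INF d\<in>D. iupper d"
  have s: "s = Abs_ival (?a, ?b)"
    using assms is_lub_on_ival is_lub_on_unique by blast
  have "?a \<le> ?b"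
  proof (intro SUP_least INF_greatest)
    fix d e assume "d \<in> D" "e \<in> D"
    with assms(2) have "d \<le> s" "e \<le> s" by (auto simp: is_lub_on_def)
    with ilower_le_iupper[of s] show "ilower d \<le> iupper e"
      by (meson less_eq_ival_iff order_trans)
  qed
  with s show "ilower s = ?a" "iupper s = ?b"
    by (simp_all add: ilower_Abs_ival iupper_Abs_ival)
qed

text \<open>If the lower end of a directed supremum exceeds \<open>t\<close>, so does that of some
  member. This set and its dual below yield the semicontinuity of the two ends of a continuous
  map.\<close>

lemma open_ilower_greater: "open {i. t < ilower i}"
  unfolding open_ival_def
proof (rule scott_openI)
  fix D s assume "directed D" "is_lub_on UNIV D s" "s \<in> {i. t < ilower i}"
  then show "D \<inter> {i. t < ilower i} \<noteq> {}"
    by (auto simp: is_lub_on_ival_bounds less_SUP_iff)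
qed (auto simp: less_eq_ival_iff)

lemma open_iupper_less: "open {i. iupper i < t}"
  unfolding open_ival_def
proof (rule scott_openI)
  fix D s assume "directed D" "is_lub_on UNIV D s" "s \<in> {i. iupper i < t}"
  then show "D \<inter> {i. iupper i < t} \<noteq> {}"
    by (auto simp: is_lub_on_ival_bounds INF_less_iff)
qed (auto simp: less_eq_ival_iff)

lemma cont_maps_lower_open:
  assumes "h \<in> cont_maps" shows "open {x. t < ilower (h x)}"
  using open_vimage[OF open_ilower_greater[of t], of h] assms
  by (simp add: cont_maps_def vimage_def)

lemma cont_maps_upper_open:
  assumes "h \<in> cont_maps" shows "open {x. iupper (h x) < t}"
  using open_vimage[OF open_iupper_less[of t], of h] assms
  by (simp add: cont_maps_def vimage_def)

text \<open>Pointwise suprema exist in the interval domain and form a continuous map, since the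
  preimage of a Scott-open set is the union of its preimages under the members. By uniqueness this
  map is \<open>s\<close>.\<close>

lemma cont_maps_lub_pointwise:
  fixes D :: "('a::topological_space \<Rightarrow> ival) set"
  assumes D: "D \<subseteq> cont_maps" "directed D" and s: "is_lub_on cont_maps D s"
  shows "is_lub_on UNIV ((\<lambda>d. d x) ` D) (s x)"
proof -
  have dir: "directed ((\<lambda>d. d x) ` D)" for x
    using D(2) by (rule directed_image_mono) (simp add: le_fun_def)
  have "\<forall>x. \<exists>i. is_lub_on UNIV ((\<lambda>d. d x) ` D) i"
    using is_lub_on_ival[OF dir] by blast
  then obtain p where p: "\<And>x. is_lub_on UNIV ((\<lambda>d. d x) ` D) (p x)"
    by metis
  have up: "d x \<le> p x" if "d \<in> D" for d x
    using p[of x] that by (auto simp: is_lub_on_def)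
  have least: "p \<le> u" if "\<forall>d\<in>D. d \<le> u" for u
    using p that by (auto simp: is_lub_on_def le_fun_def)
  have "p \<in> cont_maps"
    unfolding cont_maps_def mem_Collect_eq continuous_on_open_vimage[OF open_UNIV]
  proof (intro allI impI)
    fix U :: "ival set" assume U: "open U"
    have "p -` U = (\<Union>d\<in>D. d -` U)"
    proof (intro equalityI subsetI)
      fix x assume "x \<in> p -` U"
      then show "x \<in> (\<Union>d\<in>D. d -` U)"
        using scott_open_meets[OF _ dir p, of U x] U by (auto simp: open_ival_def)
    next
      fix x assume "x \<in> (\<Union>d\<in>D. d -` U)"
      then show "x \<in> p -` U"
        using scott_open_up[of U] up U by (auto simp: open_ival_def)
    qed
    moreover have "open (d -` U)" if "d \<in> D" for d
      using that D(1) U by (auto simp: cont_maps_def intro: open_vimage)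
    ultimately show "open (p -` U \<inter> UNIV)" by auto
  qed
  then have "is_lub_on cont_maps D p"
    using up least by (auto simp: is_lub_on_def le_fun_def)
  with s p show ?thesis
    using is_lub_on_unique by blast
qed

section \<open>Integrals with respect to finite tau-smooth measures\<close>

text \<open>Monotone convergence along the truncations at integer heights.\<close>

lemma lower_integral_eq_nn_integral:
  assumes [measurable]: "f \<in> borel_measurable M"
  shows "lower_integral M f = (\<integral>\<^sup>+ x. f x \<partial>M)"
proof (rule antisym)
  show "lower_integral M f \<le> (\<integral>\<^sup>+ x. f x \<partial>M)"
    unfolding lower_integral_def by (intro SUP_least nn_integral_mono) simp
  \<comment> \<open>Binary minimum distributes over suprema and the naturals have supremum
    \<open>\<infinity>\<close>, so points with infinite value are covered too.\<close>
  have SUP_min: "(SUP n. min (f x) (ennreal (real n))) = f x" for x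
    by (simp add: inf_min[symmetric] inf_SUP[symmetric] ennreal_SUP_of_nat_eq_top
        flip: ennreal_of_nat_eq_real_of_nat)
  have "(\<integral>\<^sup>+ x. f x \<partial>M) = (SUP n. \<integral>\<^sup>+ x. min (f x) (ennreal (real n)) \<partial>M)"
    by (subst nn_integral_monotone_convergence_SUP[symmetric])
      (auto simp: SUP_min incseq_def le_fun_def min_le_iff_disj intro!: ennreal_leI)
  also have "\<dots> \<le> lower_integral M f"
    unfolding lower_integral_def by (intro SUP_least SUP_upper) simp
  finally show "(\<integral>\<^sup>+ x. f x \<partial>M) \<le> lower_integral M f" .
qed

text \<open>Collects what the integral lemmas share; coherence is assumed where sums are formed, and
  non-vanishing where scalars act.\<close>

locale finite_tau_smooth = finite_measure M for M :: "'a::topological_space measure" +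
  assumes sets_borel: "sets M = sets borel"
    and smooth: "tau_smooth M"
begin

lemma space_UNIV: "space M = UNIV"
  using sets_eq_imp_space_eq[OF sets_borel] by simp

lemma sets_open: "open U \<Longrightarrow> U \<in> sets M"
  by (simp add: sets_borel)

lemma borel_measurable_lsc:
  fixes f :: "'a \<Rightarrow> ennreal"
  assumes "\<And>t. open {x. t < f x}" shows "f \<in> borel_measurable M"
  by (rule borel_measurableI_greater) (simp add: space_UNIV sets_open assms)

lemma borel_measurable_usc:
  fixes f :: "'a \<Rightarrow> ennreal"
  assumes "\<And>t. open {x. f x < t}" shows "f \<in> borel_measurable M"
  by (rule borel_measurableI_less) (simp add: space_UNIV sets_open assms)

section \<open>Supports as complements of null sets\<close>

text \<open>The sets \<open>- E\<close> and \<open>{}\<close> have the same trace on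
  \<open>E\<close>; conversely, sets with equal traces on \<open>E\<close> differ only inside
  \<open>- E\<close>.\<close>

lemma is_support_iff_null:
  assumes "E \<in> sets M"
  shows "is_support M E \<longleftrightarrow> emeasure M (- E) = 0"
proof
  have E: "- E \<in> sets M"
    using sets.compl_sets[OF assms] by (simp add: space_UNIV Compl_eq_Diff_UNIV)
  show "emeasure M (- E) = 0" if "is_support M E"
    using that[unfolded is_support_def, rule_format, OF E, of "{}"] by simp
  show "is_support M E" if "emeasure M (- E) = 0"
    unfolding is_support_def
  proof (intro ballI impI)
    fix A B assume AB: "A \<in> sets M" "B \<in> sets M" "A \<inter> E = B \<inter> E"
    have "- E \<in> null_sets M" using E that by auto
    then have "AE x in M. x \<in> A \<longleftrightarrow> x \<in> B"
      by (rule AE_I') (use AB(3) in blast)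
    with AB show "emeasure M A = emeasure M B" by (intro emeasure_eq_AE)
  qed
qed

lemma closed_supp: "closed (supp M)"
  unfolding supp_def by (intro closed_Inter) simp

text \<open>The complement is the union of all open null sets. These are directed because they are
  closed under binary union, so \<tau>-smoothness makes their union null.\<close>

lemma emeasure_Compl_supp: "emeasure M (- supp M) = 0"
proof -
  define \<U> where "\<U> = {U. open U \<and> emeasure M U = 0}"
  have compl: "- supp M = \<Union>\<U>"
  proof (intro equalityI subsetI)
    fix x assume "x \<in> - supp M"
    then obtain E where "closed E" "is_support M E" "x \<notin> E" by (auto simp: supp_def)
    then have "- E \<in> \<U>" "x \<in> - E"
      using is_support_iff_null[of E] by (auto simp: \<U>_def sets_borel)
    then show "x \<in> \<Union>\<U>" by blast
  next
    fix x assume "x \<in> \<Union>\<U>"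
    then obtain U where "U \<in> \<U>" "x \<in> U" by blast
    then have "closed (- U)" "is_support M (- U)" "x \<notin> - U"
      using is_support_iff_null[of "- U"] by (auto simp: \<U>_def sets_borel)
    then show "x \<in> - supp M" by (auto simp: supp_def)
  qed
  have "directed \<U>"
    unfolding directed_def
  proof (intro conjI ballI)
    have "{} \<in> \<U>" by (simp add: \<U>_def)
    then show "\<U> \<noteq> {}" by blast
    fix U V assume "U \<in> \<U>" "V \<in> \<U>"
    then have "U \<union> V \<in> \<U>"
      using null_sets.Un[of U M V] by (auto simp: \<U>_def null_sets_def sets_open)
    then show "\<exists>W\<in>\<U>. U \<subseteq> W \<and> V \<subseteq> W" by blast
  qed
  then have "emeasure M (\<Union>\<U>) = (SUP U\<in>\<U>. emeasure M U)"
    using smooth by (auto simp: tau_smooth_def \<U>_def)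
  then show ?thesis by (simp add: compl \<U>_def SUP_constant bot_ennreal)
qed

text \<open>Turns bounds on \<open>Q \<inter> supp M\<close> into bounds almost everywhere.\<close>

lemma AE_support_supp:
  assumes "Q \<in> sets M" "is_support M Q"
  shows "AE x in M. x \<in> Q \<inter> supp M"
proof (rule AE_I')
  have "- Q \<in> null_sets M" "- supp M \<in> null_sets M"
    using assms is_support_iff_null[of Q] emeasure_Compl_supp closed_supp
      sets.compl_sets[OF assms(1)]
    by (auto simp: null_sets_def sets_open space_UNIV Compl_eq_Diff_UNIV[symmetric] open_Compl)
  then show "- Q \<union> - supp M \<in> null_sets M" by (rule null_sets.Un)
qed (auto simp: space_UNIV)

section \<open>From directed families to monotone sequences\<close>

text \<open>One increasing sequence serves countably many level sets at once. By \<tau>-smoothness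
  each union over \<open>D\<close> has its measure approximated by countably many members; the
  sequence dominates all of these, and finiteness of \<open>M\<close> makes what it misses null. The
  prescribed start \<open>i\<close> lets decreasing limits begin at a finite integral.\<close>

lemma directed_sequence:
  fixes D :: "'i::order set" and U :: "nat \<Rightarrow> 'i \<Rightarrow> 'a set"
  assumes D: "directed D" and "i \<in> D"
    and op: "\<And>q d. d \<in> D \<Longrightarrow> open (U q d)"
    and mono: "\<And>q d e. d \<in> D \<Longrightarrow> e \<in> D \<Longrightarrow> d \<le> e \<Longrightarrow> U q d \<subseteq> U q e"
  obtains d :: "nat \<Rightarrow> 'i"
  where "incseq d" "range d \<subseteq> D" "d 0 = i"
    "AE x in M. \<forall>q. x \<in> (\<Union>e\<in>D. U q e) \<longrightarrow> x \<in> (\<Union>n. U q (d n))"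
proof -
  have "\<exists>e::nat \<Rightarrow> 'i. range e \<subseteq> D \<and> emeasure M (\<Union>d\<in>D. U q d) = (SUP n. emeasure M (U q (e n)))"
    for q
  proof -
    have "directed (U q ` D)" using D mono by (rule directed_image_mono)
    then have eq: "emeasure M (\<Union>d\<in>D. U q d) = (SUP d\<in>D. emeasure M (U q d))"
      using smooth op by (auto simp: tau_smooth_def image_image)
    have "(\<lambda>d. emeasure M (U q d)) ` D \<noteq> {}" using \<open>i \<in> D\<close> by blast
    from ennreal_Sup_countable_SUP[OF this] obtain f :: "nat \<Rightarrow> ennreal"
      where f: "range f \<subseteq> (\<lambda>d. emeasure M (U q d)) ` D"
        "(SUP d\<in>D. emeasure M (U q d)) = (SUP n. f n)" by blast
    then have "\<forall>n. \<exists>d\<in>D. f n = emeasure M (U q d)" by blast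
    then obtain e where "\<And>n. e n \<in> D \<and> f n = emeasure M (U q (e n))" by metis
    with f(2) eq show ?thesis by (intro exI[of _ e]) auto
  qed
  then obtain e :: "nat \<Rightarrow> nat \<Rightarrow> 'i" where eD: "\<And>q n. e q n \<in> D"
    and e: "\<And>q. emeasure M (\<Union>d\<in>D. U q d) = (SUP n. emeasure M (U q (e q n)))"
    by (metis rangeI subsetD)
  \<comment> \<open>A single enumeration of all the approximating indices
    \<open>e q n\<close>.\<close>
  define c where "c n = case_prod e (prod_decode n)" for n
  have cD: "c n \<in> D" for n using eD by (simp add: c_def split: prod.split)
  have "\<exists>d. \<forall>n. (d n \<in> D \<and> (n = 0 \<longrightarrow> d n = i)) \<and> (d n \<le> d (Suc n) \<and> c n \<le> d (Suc n))"
  proof (rule dependent_nat_choice)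
    show "\<exists>x. x \<in> D \<and> (0 = (0::nat) \<longrightarrow> x = i)" using \<open>i \<in> D\<close> by blast
    fix x and n :: nat assume "x \<in> D \<and> (n = 0 \<longrightarrow> x = i)"
    then obtain z where "z \<in> D" "x \<le> z" "c n \<le> z" using directedE[OF D _ cD] by blast
    then show "\<exists>y. (y \<in> D \<and> (Suc n = 0 \<longrightarrow> y = i)) \<and> x \<le> y \<and> c n \<le> y" by blast
  qed
  then obtain d where dD: "\<And>n. d n \<in> D" and d0: "d 0 = i"
    and dSuc: "\<And>n. d n \<le> d (Suc n)" and cd: "\<And>n. c n \<le> d (Suc n)" by blast
  have "AE x in M. x \<in> (\<Union>e\<in>D. U q e) \<longrightarrow> x \<in> (\<Union>n. U q (d n))" for q
  proof -
    let ?A = "\<Union>e\<in>D. U q e" and ?B = "\<Union>n. U q (d n)"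
    have sets: "?A \<in> sets M" "?B \<in> sets M"
      using op dD by (auto intro!: sets_open)
    have "emeasure M ?A \<le> emeasure M ?B"
      unfolding e
    proof (rule SUP_least)
      fix n
      \<comment> \<open>The index with code \<open>k\<close> is dominated only from
        \<open>d (Suc k)\<close> on, whence the shift.\<close>
      have "U q (e q n) \<subseteq> U q (d (Suc (prod_encode (q, n))))"
        using cd[of "prod_encode (q, n)"] by (intro mono eD dD) (simp add: c_def)
      then show "emeasure M (U q (e q n)) \<le> emeasure M ?B"
        using sets by (intro emeasure_mono) auto
    qed
    moreover have "?B \<subseteq> ?A" using dD by blast
    \<comment> \<open>Subtracting measures is legitimate because \<open>?B\<close> has finite
      measure.\<close>
    ultimately have "emeasure M (?A - ?B) = 0"
      using sets by (subst emeasure_Diff) (auto simp: diff_eq_0_iff_ennreal less_top[symmetric])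
    then show ?thesis
      using sets by (intro AE_I'[of "?A - ?B"]) auto
  qed
  then have "AE x in M. \<forall>q. x \<in> (\<Union>e\<in>D. U q e) \<longrightarrow> x \<in> (\<Union>n. U q (d n))"
    by (simp add: AE_all_countable)
  with dSuc dD d0 show thesis by (intro that[of d]) (auto intro: incseq_SucI)
qed

text \<open>The strict upper level sets at rational heights are open. Off a null set the sequence
  passes every rational level that the directed supremum exceeds, so both suprema agree there, and
  monotone convergence applies to the sequence.\<close>

lemma nn_integral_directed_SUP_lsc:
  fixes f :: "'i::order \<Rightarrow> 'a \<Rightarrow> ennreal"
  assumes D: "directed D"
    and lsc: "\<And>d t. d \<in> D \<Longrightarrow> open {x. t < f d x}"
    and mono: "\<And>d e. d \<in> D \<Longrightarrow> e \<in> D \<Longrightarrow> d \<le> e \<Longrightarrow> f d \<le> f e"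
  shows "(\<integral>\<^sup>+ x. (SUP d\<in>D. f d x) \<partial>M) = (SUP d\<in>D. \<integral>\<^sup>+ x. f d x \<partial>M)"
proof (rule antisym)
  obtain i where "i \<in> D" using D by (auto simp: directed_def)
  \<comment> \<open>Enumerates the rationals; negative ones become \<open>0\<close>, which is
    harmless.\<close>
  define r :: "nat \<Rightarrow> ennreal" where "r q = ennreal (of_rat (from_nat q))" for q
  have level_mono: "{x. r q < f d x} \<subseteq> {x. r q < f e x}" if "d \<in> D" "e \<in> D" "d \<le> e" for q d e
    using mono[OF that] by (auto simp: le_fun_def intro: order_less_le_trans)
  obtain d where d: "incseq d" "range d \<subseteq> D"
    and AE: "AE x in M. \<forall>q. x \<in> (\<Union>e\<in>D. {x. r q < f e x}) \<longrightarrow> x \<in> (\<Union>n. {x. r q < f (d n) x})"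
    using directed_sequence[of D i "\<lambda>q e. {x. r q < f e x}", OF D \<open>i \<in> D\<close> lsc level_mono] by blast
  have dD: "d n \<in> D" for n using d(2) by blast
  have "AE x in M. (SUP e\<in>D. f e x) = (SUP n. f (d n) x)"
    using AE
  proof eventually_elim
    case (elim x)
    show ?case
    proof (rule antisym)
      show "(SUP e\<in>D. f e x) \<le> (SUP n. f (d n) x)"
      proof (rule ccontr)
        assume "\<not> ?thesis"
        then have "(SUP n. f (d n) x) < (SUP e\<in>D. f e x)" by simp
        then obtain p where p: "(SUP n. f (d n) x) < ennreal (of_rat p)"
          "ennreal (of_rat p) < (SUP e\<in>D. f e x)"
          using ennreal_rat_dense by blast
        then have q: "r (to_nat p) = ennreal (of_rat p)" by (simp add: r_def)
        from p(2) obtain e where "e \<in> D" "r (to_nat p) < f e x" by (auto simp: less_SUP_iff q)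
        with elim obtain n where "r (to_nat p) < f (d n) x" by blast
        then have "r (to_nat p) < (SUP n. f (d n) x)" by (auto simp: less_SUP_iff)
        with p(1) q show False by simp
      qed
      show "(SUP n. f (d n) x) \<le> (SUP e\<in>D. f e x)" using dD by (auto intro!: SUP_least SUP_upper)
    qed
  qed
  then have "(\<integral>\<^sup>+ x. (SUP e\<in>D. f e x) \<partial>M) = (\<integral>\<^sup>+ x. (SUP n. f (d n) x) \<partial>M)"
    by (rule nn_integral_cong_AE)
  also have "\<dots> = (SUP n. \<integral>\<^sup>+ x. f (d n) x \<partial>M)"
  proof (rule nn_integral_monotone_convergence_SUP)
    show "incseq (\<lambda>n. f (d n))"
      using d(1) dD mono by (simp add: incseq_def)
    show "f (d n) \<in> borel_measurable M" for n
      using lsc[OF dD] by (rule borel_measurable_lsc)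
  qed
  also have "\<dots> \<le> (SUP d\<in>D. \<integral>\<^sup>+ x. f d x \<partial>M)" using dD by (auto intro!: SUP_least SUP_upper)
  finally show "(\<integral>\<^sup>+ x. (SUP d\<in>D. f d x) \<partial>M) \<le> (SUP d\<in>D. \<integral>\<^sup>+ x. f d x \<partial>M)" .
qed (auto intro!: SUP_least nn_integral_mono SUP_upper)

text \<open>Dual argument with strict lower level sets; decreasing convergence requires the finite
  integral at \<open>i\<close>. The sequence itself is returned because the integrals along it must
  later be recognised as upper integrals, which works above a bounded member.\<close>

lemma nn_integral_directed_INF_usc:
  fixes f :: "'i::order \<Rightarrow> 'a \<Rightarrow> ennreal"
  assumes D: "directed D"
    and usc: "\<And>d t. d \<in> D \<Longrightarrow> open {x. f d x < t}"
    and mono: "\<And>d e. d \<in> D \<Longrightarrow> e \<in> D \<Longrightarrow> d \<le> e \<Longrightarrow> f e \<le> f d"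
    and i: "i \<in> D" "(\<integral>\<^sup>+ x. f i x \<partial>M) < \<infinity>"
  obtains d where "range d \<subseteq> D" "d (0::nat) = i" "incseq d"
    "(\<integral>\<^sup>+ x. (INF e\<in>D. f e x) \<partial>M) = (INF n. \<integral>\<^sup>+ x. f (d n) x \<partial>M)"
proof -
  define r :: "nat \<Rightarrow> ennreal" where "r q = ennreal (of_rat (from_nat q))" for q
  have level_mono: "{x. f d x < r q} \<subseteq> {x. f e x < r q}" if "d \<in> D" "e \<in> D" "d \<le> e" for q d e
    using mono[OF that] by (auto simp: le_fun_def intro: order_le_less_trans)
  obtain d where d: "incseq d" "range d \<subseteq> D" "d 0 = i"
    and AE: "AE x in M. \<forall>q. x \<in> (\<Union>e\<in>D. {x. f e x < r q}) \<longrightarrow> x \<in> (\<Union>n. {x. f (d n) x < r q})"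
    using directed_sequence[of D i "\<lambda>q e. {x. f e x < r q}", OF D \<open>i \<in> D\<close> usc level_mono] by blast
  have dD: "d n \<in> D" for n using d(2) by blast
  have "AE x in M. (INF e\<in>D. f e x) = (INF n. f (d n) x)"
    using AE
  proof eventually_elim
    case (elim x)
    show ?case
    proof (rule antisym)
      show "(INF n. f (d n) x) \<le> (INF e\<in>D. f e x)"
      proof (rule ccontr)
        assume "\<not> ?thesis"
        then have "(INF e\<in>D. f e x) < (INF n. f (d n) x)" by simp
        then obtain p where p: "(INF e\<in>D. f e x) < ennreal (of_rat p)"
          "ennreal (of_rat p) < (INF n. f (d n) x)"
          using ennreal_rat_dense by blast
        then have q: "r (to_nat p) = ennreal (of_rat p)" by (simp add: r_def)
        from p(1) obtain e where "e \<in> D" "f e x < r (to_nat p)" by (auto simp: INF_less_iff q)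
        with elim obtain n where "f (d n) x < r (to_nat p)" by blast
        then have "(INF n. f (d n) x) < r (to_nat p)" by (auto simp: INF_less_iff)
        with p(2) q show False by simp
      qed
      show "(INF e\<in>D. f e x) \<le> (INF n. f (d n) x)" using dD by (auto intro!: INF_greatest INF_lower)
    qed
  qed
  then have "(\<integral>\<^sup>+ x. (INF e\<in>D. f e x) \<partial>M) = (\<integral>\<^sup>+ x. (INF n. f (d n) x) \<partial>M)"
    by (rule nn_integral_cong_AE)
  also have "\<dots> = (INF n. \<integral>\<^sup>+ x. f (d n) x \<partial>M)"
  proof (rule nn_integral_monotone_convergence_INF_decseq)
    show "decseq (\<lambda>n. f (d n))"
      using d(1) dD mono by (simp add: incseq_def decseq_def)
    show "f (d n) \<in> borel_measurable M" for n
      using usc[OF dD] by (rule borel_measurable_usc)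
    show "(\<integral>\<^sup>+ x. f (d 0) x \<partial>M) < \<infinity>" using i d(3) by simp
  qed
  finally show thesis using that d by blast
qed

section \<open>Boundedness on compact saturated supports\<close>

lemma bounded_wrtE:
  assumes "bounded_wrt M f"
  obtains Q b where "Q \<in> sets M" "compact Q" "saturated Q" "is_support M Q"
    "b < \<infinity>" "\<And>x. x \<in> Q \<inter> supp M \<Longrightarrow> f x \<le> b"
  using assms unfolding bounded_wrt_def by (meson SUP_upper)

lemma bounded_wrtI:
  assumes "Q \<in> sets M" "compact Q" "saturated Q" "is_support M Q"
    "b < \<infinity>" "\<And>x. x \<in> Q \<inter> supp M \<Longrightarrow> f x \<le> b"
  shows "bounded_wrt M f"
  using assms unfolding bounded_wrt_def by (meson SUP_least order_le_less_trans)

lemma bounded_wrt_mono: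
  assumes "bounded_wrt M g" "\<And>x. f x \<le> g x"
  shows "bounded_wrt M f"
  using assms by (meson bounded_wrtE bounded_wrtI order_trans)

lemma bounded_wrt_AE:
  assumes "bounded_wrt M f"
  obtains b where "b < \<infinity>" "AE x in M. f x \<le> b"
proof -
  obtain Q b where Q: "Q \<in> sets M" "is_support M Q" and b: "b < \<infinity>"
    and le: "\<And>x. x \<in> Q \<inter> supp M \<Longrightarrow> f x \<le> b"
    using assms by (rule bounded_wrtE) blast
  have "AE x in M. f x \<le> b"
    using AE_support_supp[OF Q] by eventually_elim (rule le)
  with b show thesis by (rule that)
qed

lemma bounded_wrt_nn_integral_finite:
  assumes "bounded_wrt M f"
  shows "(\<integral>\<^sup>+ x. f x \<partial>M) < \<infinity>"
proof -
  obtain b where b: "b < \<infinity>" "AE x in M. f x \<le> b" using assms by (rule bounded_wrt_AE)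
  then have "(\<integral>\<^sup>+ x. f x \<partial>M) \<le> (\<integral>\<^sup>+ x. b \<partial>M)" by (intro nn_integral_mono_AE)
  also have "\<dots> < \<infinity>" using b(1) by (simp add: less_top[symmetric] ennreal_mult_eq_top_iff)
  finally show ?thesis .
qed

text \<open>A bound would give \<open>\<infinity> \<le> b < \<infinity>\<close> almost everywhere,
  forcing the measure to vanish.\<close>

lemma bounded_wrt_const_infinity:
  assumes "emeasure M UNIV \<noteq> 0"
  shows "\<not> bounded_wrt M (\<lambda>x. \<infinity>)"
proof
  assume "bounded_wrt M (\<lambda>x. \<infinity>)"
  then obtain b :: ennreal where "b < \<infinity>" "AE x in M. \<infinity> \<le> b" by (rule bounded_wrt_AE)
  then have "AE x in M. False" by (auto elim!: eventually_mono simp: top_unique)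
  then have "emeasure M (space M) = 0" by (simp add: AE_iff_measurable[OF sets.top])
  with assms show False by (simp add: space_UNIV)
qed

text \<open>The open sets on which a member stays below \<open>b + 1\<close> cover the compact set
  \<open>Q \<inter> supp M\<close>. A finite subcover suffices, and an index above all those
  involved gives the bounded member.\<close>

lemma usc_directed_INF_bounded:
  fixes f :: "'i::order \<Rightarrow> 'a \<Rightarrow> ennreal"
  assumes D: "directed D"
    and usc: "\<And>d t. d \<in> D \<Longrightarrow> open {x. f d x < t}"
    and mono: "\<And>d e. d \<in> D \<Longrightarrow> e \<in> D \<Longrightarrow> d \<le> e \<Longrightarrow> f e \<le> f d"
    and bdd: "bounded_wrt M (\<lambda>x. INF d\<in>D. f d x)"
  obtains i where "i \<in> D" "bounded_wrt M (f i)"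
proof -
  obtain Q b where Q: "Q \<in> sets M" "compact Q" "saturated Q" "is_support M Q"
    and b: "b < \<infinity>" and le: "\<And>x. x \<in> Q \<inter> supp M \<Longrightarrow> (INF d\<in>D. f d x) \<le> b"
    using bdd by (rule bounded_wrtE) blast
  let ?U = "\<lambda>d. {x. f d x < b + 1}"
  \<comment> \<open>The slack gives a strict inequality, hence open sets; it exists because
    \<open>b\<close> is finite.\<close>
  have "b < b + 1" using b by (cases b) (simp_all add: ennreal_less_iff flip: ennreal_1 ennreal_plus)
  then have "Q \<inter> supp M \<subseteq> (\<Union>d\<in>D. ?U d)"
    using le by (force simp: INF_less_iff dest: order_le_less_trans)
  moreover have "compact (Q \<inter> supp M)" using Q(2) closed_supp by (rule compact_Int_closed)
  ultimately obtain C where C: "C \<subseteq> D" "finite C" "Q \<inter> supp M \<subseteq> (\<Union>d\<in>C. ?U d)"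
    using usc by (rule_tac compactE_image[of "Q \<inter> supp M" D ?U]) auto
  have "\<exists>i\<in>D. \<forall>d\<in>C. d \<le> i"
    using C(2,1)
  proof (induction C rule: finite_induct)
    case empty then show ?case using D by (auto simp: directed_def)
  next
    case (insert c C)
    then obtain j where "j \<in> D" "\<forall>d\<in>C. d \<le> j" by blast
    moreover from insert.prems this(1) obtain k where "k \<in> D" "c \<le> k" "j \<le> k"
      using directedE[OF D] by (metis insert_subset)
    ultimately show ?case by (metis insertE order_trans)
  qed
  then obtain i where i: "i \<in> D" "\<forall>d\<in>C. d \<le> i" by blast
  have "f i x \<le> b + 1" if "x \<in> Q \<inter> supp M" for x
  proof -
    obtain d where "d \<in> C" "f d x < b + 1" using C(3) \<open>x \<in> Q \<inter> supp M\<close> by blast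
    moreover have "f i x \<le> f d x" using mono[of d i] i C(1) \<open>d \<in> C\<close> by (auto simp: le_fun_def)
    ultimately show ?thesis by simp
  qed
  moreover have "b + 1 < \<infinity>" using b by simp
  ultimately have "bounded_wrt M (f i)" using Q by (intro bounded_wrtI)
  with i(1) show thesis by (rule that)
qed

text \<open>Compactness again, now with the cover of \<open>Q \<inter> supp M\<close> by the open
  sets where \<open>f\<close> is below a natural number.\<close>

lemma usc_finite_bounded_wrt:
  fixes f :: "'a \<Rightarrow> ennreal"
  assumes usc: "\<And>t. open {x. f x < t}"
    and Q: "Q \<in> sets M" "compact Q" "saturated Q" "is_support M Q"
    and fin: "\<And>x. x \<in> Q \<inter> supp M \<Longrightarrow> f x < \<infinity>"
  shows "bounded_wrt M f"
proof -
  let ?U = "\<lambda>n::nat. {x. f x < of_nat n}"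
  have "Q \<inter> supp M \<subseteq> (\<Union>n. ?U n)"
    using fin ennreal_Ex_less_of_nat by fastforce
  moreover have "compact (Q \<inter> supp M)" using Q(2) closed_supp by (rule compact_Int_closed)
  ultimately obtain N where N: "finite N" "Q \<inter> supp M \<subseteq> (\<Union>n\<in>N. ?U n)"
    using usc by (rule_tac compactE_image[of "Q \<inter> supp M" UNIV ?U]) auto
  \<comment> \<open>The sum of \<open>N\<close> dominates each of its elements and is defined even
    for empty \<open>N\<close>.\<close>
  have "f x \<le> of_nat (\<Sum>n\<in>N. n)" if "x \<in> Q \<inter> supp M" for x
  proof -
    obtain n where n: "n \<in> N" "f x < of_nat n" using N(2) \<open>x \<in> Q \<inter> supp M\<close> by blast
    then have "n \<le> (\<Sum>n\<in>N. n)" using N(1) by (intro member_le_sum) auto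
    then have "(of_nat n :: ennreal) \<le> of_nat (\<Sum>n\<in>N. n)" by (simp only: of_nat_le_iff)
    with n(2) show ?thesis by (meson order_less_imp_le order_trans)
  qed
  moreover have "(of_nat (\<Sum>n\<in>N. n) :: ennreal) < \<infinity>" by (simp only: infinity_ennreal_def of_nat_less_top)
  ultimately show ?thesis using Q by (intro bounded_wrtI)
qed

text \<open>Each summand inherits the support and bound of the sum. Conversely the two supports are
  intersected: coherence keeps the intersection compact, and its complement is a union of two null
  sets.\<close>

lemma bounded_wrt_add_iff:
  assumes "coherent_space TYPE('a)"
  shows "bounded_wrt M (\<lambda>x. f x + g x) \<longleftrightarrow> bounded_wrt M f \<and> bounded_wrt M g"
proof (intro iffI conjI; (elim conjE)?)
  assume "bounded_wrt M (\<lambda>x. f x + g x)"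
  then show "bounded_wrt M f" "bounded_wrt M g"
    by (auto elim!: bounded_wrt_mono)
next
  assume "bounded_wrt M f" "bounded_wrt M g"
  obtain Q b where Q: "Q \<in> sets M" "compact Q" "saturated Q" "is_support M Q"
    and b: "b < \<infinity>" "\<And>x. x \<in> Q \<inter> supp M \<Longrightarrow> f x \<le> b"
    using \<open>bounded_wrt M f\<close> by (rule bounded_wrtE) blast
  obtain Q' b' where Q': "Q' \<in> sets M" "compact Q'" "saturated Q'" "is_support M Q'"
    and b': "b' < \<infinity>" "\<And>x. x \<in> Q' \<inter> supp M \<Longrightarrow> g x \<le> b'"
    using \<open>bounded_wrt M g\<close> by (rule bounded_wrtE) blast
  show "bounded_wrt M (\<lambda>x. f x + g x)"
  proof (rule bounded_wrtI)
    show QQ: "Q \<inter> Q' \<in> sets M" using Q(1) Q'(1) by blast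
    show "compact (Q \<inter> Q')" using assms Q Q' by (simp add: coherent_space_def)
    obtain \<U> \<V> where "\<forall>U\<in>\<U>. open U" "Q = \<Inter>\<U>" "\<forall>U\<in>\<V>. open U" "Q' = \<Inter>\<V>"
      using Q(3) Q'(3) unfolding saturated_def by blast
    then show "saturated (Q \<inter> Q')"
      unfolding saturated_def by (intro exI[of _ "\<U> \<union> \<V>"]) auto
    have "emeasure M (- Q) = 0" "emeasure M (- Q') = 0"
      using Q Q' is_support_iff_null by blast+
    moreover have "- Q \<in> sets M" "- Q' \<in> sets M"
      using sets.compl_sets[OF Q(1)] sets.compl_sets[OF Q'(1)]
      by (simp_all add: space_UNIV Compl_eq_Diff_UNIV)
    ultimately have "- Q \<union> - Q' \<in> null_sets M" by (intro null_sets.Un) auto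
    then show "is_support M (Q \<inter> Q')"
      using is_support_iff_null[OF QQ] by (auto simp: Compl_Int)
    show "b + b' < \<infinity>" using b b' by simp
    show "f x + g x \<le> b + b'" if "x \<in> Q \<inter> Q' \<inter> supp M" for x
      using that b(2) b'(2) by (intro add_mono) auto
  qed
qed

section \<open>Sums, scalars and directed infima under the upper integral\<close>

lemma upper_integral_eq:
  assumes "f \<in> borel_measurable M"
  shows "upper_integral M f = (if bounded_wrt M f then \<integral>\<^sup>+ x. f x \<partial>M else \<infinity>)"
  using assms by (simp add: upper_integral_def lower_integral_eq_nn_integral)

lemma upper_integral_mono:
  assumes "f \<in> borel_measurable M" "g \<in> borel_measurable M" "\<And>x. f x \<le> g x"
  shows "upper_integral M f \<le> upper_integral M g"
  using assms bounded_wrt_mono[of g f] by (auto simp: upper_integral_eq intro: nn_integral_mono)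

lemma upper_integral_add:
  assumes "coherent_space TYPE('a)"
    and [measurable]: "f \<in> borel_measurable M" "g \<in> borel_measurable M"
  shows "upper_integral M (\<lambda>x. f x + g x) = upper_integral M f + upper_integral M g"
  by (simp add: upper_integral_eq bounded_wrt_add_iff[OF assms(1)] nn_integral_add)

text \<open>The convention that \<open>0\<close> times \<open>\<infinity>\<close> is
  \<open>\<infinity>\<close> forces separate treatment of the scalars \<open>0\<close> and
  \<open>\<infinity>\<close>.\<close>

lemma upper_integral_times_upper:
  fixes f :: "'a \<Rightarrow> ennreal"
  assumes nonzero: "emeasure M UNIV \<noteq> 0"
    and usc: "\<And>t. open {x. f x < t}"
  shows "upper_integral M (\<lambda>x. times_upper b (f x)) = times_upper b (upper_integral M f)"
proof -
  have f[measurable]: "f \<in> borel_measurable M" using usc by (rule borel_measurable_usc)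
  have [measurable]: "(\<lambda>x. times_upper b (f x)) \<in> borel_measurable M"
    unfolding times_upper_def by measurable
  consider "b = 0" | "b = \<infinity>" | "0 < b" "b < \<infinity>"
    by (metis infinity_ennreal_def not_gr_zero top.not_eq_extremum)
  then show ?thesis
  proof cases
    case 1
    \<comment> \<open>Multiplication by \<open>0\<close> records only whether a value is infinite,
      so the claim becomes: the new integrand is bounded exactly when \<open>f\<close> is.\<close>
    have zero: "times_upper b y = (if y = \<infinity> then \<infinity> else 0)" for y
      using 1 by (simp add: times_upper_def)
    show ?thesis
    proof (cases "bounded_wrt M f")
      case True
      then obtain Q c where Q: "Q \<in> sets M" "compact Q" "saturated Q" "is_support M Q"
        and c: "c < \<infinity>" "\<And>x. x \<in> Q \<inter> supp M \<Longrightarrow> f x \<le> c"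
        by (rule bounded_wrtE) blast
      then have z: "times_upper b (f x) = 0" if "x \<in> Q \<inter> supp M" for x
        using that by (fastforce simp: zero top_unique)
      then have "bounded_wrt M (\<lambda>x. times_upper b (f x))"
        using Q by (intro bounded_wrtI[of Q 0]) auto
      moreover have "(\<integral>\<^sup>+ x. times_upper b (f x) \<partial>M) = (\<integral>\<^sup>+ x. 0 \<partial>M)"
      proof (rule nn_integral_cong_AE)
        show "AE x in M. times_upper b (f x) = 0"
          using AE_support_supp[OF Q(1,4)] by eventually_elim (rule z)
      qed
      ultimately show ?thesis
        using True bounded_wrt_nn_integral_finite[OF True] by (simp add: upper_integral_eq zero)
    next
      case False
      \<comment> \<open>A bound on the product only says that \<open>f\<close> is finite on
        \<open>Q \<inter> supp M\<close>; upper semicontinuity and compactness upgrade this to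
        boundedness.\<close>
      have "\<not> bounded_wrt M (\<lambda>x. times_upper b (f x))"
      proof
        assume "bounded_wrt M (\<lambda>x. times_upper b (f x))"
        then obtain Q c where Q: "Q \<in> sets M" "compact Q" "saturated Q" "is_support M Q"
          and c: "c < \<infinity>" "\<And>x. x \<in> Q \<inter> supp M \<Longrightarrow> times_upper b (f x) \<le> c"
          by (rule bounded_wrtE) blast
        have "f x < \<infinity>" if "x \<in> Q \<inter> supp M" for x
          using c(1) c(2)[OF that] by (auto simp: zero top_unique less_top split: if_splits)
        with usc Q False show False using usc_finite_bounded_wrt by blast
      qed
      with False show ?thesis by (simp add: upper_integral_eq zero)
    qed
  next
    case 2
    \<comment> \<open>This includes \<open>y = 0\<close>, so the integrand is constantly
      \<open>\<infinity>\<close>, which is not bounded for a non-zero measure.\<close>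
    then have "times_upper b y = \<infinity>" for y
      by (simp add: times_upper_def ennreal_top_mult)
    then show ?thesis
      using bounded_wrt_const_infinity[OF nonzero] by (simp add: upper_integral_def)
  next
    case 3
    then have mult: "times_upper b y = b * y" for y by (auto simp: times_upper_def)
    have "bounded_wrt M (\<lambda>x. b * f x) \<longleftrightarrow> bounded_wrt M f"
    proof
      assume "bounded_wrt M f"
      then obtain Q c where Q: "Q \<in> sets M" "compact Q" "saturated Q" "is_support M Q"
        and c: "c < \<infinity>" "\<And>x. x \<in> Q \<inter> supp M \<Longrightarrow> f x \<le> c"
        by (rule bounded_wrtE) blast
      have "b * c < \<infinity>" using 3 c(1) by (simp add: ennreal_mult_less_top)
      with Q c(2) show "bounded_wrt M (\<lambda>x. b * f x)"
        by (auto intro!: bounded_wrtI[of Q "b * c"] mult_left_mono)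
    next
      assume "bounded_wrt M (\<lambda>x. b * f x)"
      then obtain Q c where Q: "Q \<in> sets M" "compact Q" "saturated Q" "is_support M Q"
        and c: "c < \<infinity>" "\<And>x. x \<in> Q \<inter> supp M \<Longrightarrow> b * f x \<le> c"
        by (rule bounded_wrtE) blast
      \<comment> \<open>Since \<open>b\<close> is positive, an infinite \<open>f x\<close> would
        make the product infinite; finiteness suffices, so no division by \<open>b\<close> is
        made.\<close>
      have "f x < \<infinity>" if "x \<in> Q \<inter> supp M" for x
        using c(1) c(2)[OF that] 3(1) by (auto simp: less_top[symmetric] ennreal_mult_top top_unique split: if_splits)
      with usc Q show "bounded_wrt M f" by (rule usc_finite_bounded_wrt)
    qed
    with 3(1) show ?thesis by (auto simp: upper_integral_eq mult nn_integral_cmult ennreal_mult_top)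
  qed
qed

text \<open>Only the second inequality is substantial. If the infimum is unbounded, its upper
  integral is \<open>\<infinity>\<close>; otherwise some member is bounded, and a sequence starting
  there computes the integral.\<close>

lemma upper_integral_directed_INF:
  fixes f :: "'i::order \<Rightarrow> 'a \<Rightarrow> ennreal"
  assumes D: "directed D"
    and usc: "\<And>d t. d \<in> D \<Longrightarrow> open {x. f d x < t}"
    and mono: "\<And>d e. d \<in> D \<Longrightarrow> e \<in> D \<Longrightarrow> d \<le> e \<Longrightarrow> f e \<le> f d"
  shows "upper_integral M (\<lambda>x. INF d\<in>D. f d x) = (INF d\<in>D. upper_integral M (f d))"
proof (rule antisym)
  have fm: "f d \<in> borel_measurable M" if "d \<in> D" for d
    using usc[OF that] by (rule borel_measurable_usc)
  have "{x. (INF d\<in>D. f d x) < t} = (\<Union>d\<in>D. {x. f d x < t})" for t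
    by (auto simp: INF_less_iff)
  then have INFm: "(\<lambda>x. INF d\<in>D. f d x) \<in> borel_measurable M"
    using usc by (intro borel_measurable_usc) auto
  show "upper_integral M (\<lambda>x. INF d\<in>D. f d x) \<le> (INF d\<in>D. upper_integral M (f d))"
    by (intro INF_greatest upper_integral_mono INFm fm INF_lower)
  show "(INF d\<in>D. upper_integral M (f d)) \<le> upper_integral M (\<lambda>x. INF d\<in>D. f d x)"
  proof (cases "bounded_wrt M (\<lambda>x. INF d\<in>D. f d x)")
    case True
    obtain i where i: "i \<in> D" "bounded_wrt M (f i)"
      using usc_directed_INF_bounded[of D f, OF D usc mono True] by blast
    obtain d where d: "range d \<subseteq> D" "d (0::nat) = i" "incseq d"
      and eq: "(\<integral>\<^sup>+ x. (INF e\<in>D. f e x) \<partial>M) = (INF n. \<integral>\<^sup>+ x. f (d n) x \<partial>M)"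
      using nn_integral_directed_INF_usc[of D f, OF D usc mono i(1) bounded_wrt_nn_integral_finite[OF i(2)]]
      by blast
    have "upper_integral M (f (d n)) = (\<integral>\<^sup>+ x. f (d n) x \<partial>M)" for n
    proof -
      \<comment> \<open>All terms lie above the bounded member \<open>i\<close>, so their upper
        integrals are Lebesgue integrals.\<close>
      have "i \<le> d n" using incseqD[OF d(3), of 0 n] d(2) by simp
      then have "bounded_wrt M (f (d n))"
        using mono[of i "d n"] d(1) i by (intro bounded_wrt_mono[OF i(2)]) (auto simp: le_fun_def)
      then show ?thesis using fm d(1) by (simp add: upper_integral_eq range_subsetD)
    qed
    then have "upper_integral M (\<lambda>x. INF d\<in>D. f d x) = (INF n. upper_integral M (f (d n)))"
      using True eq INFm by (simp add: upper_integral_eq)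
    with d(1) show ?thesis by (auto intro!: INF_greatest INF_lower)
  qed (simp add: upper_integral_def)
qed

end

section \<open>Scott continuity, homogeneity and additivity of the interval integral\<close>

theorem proposition7p7:
  fixes \<mu> :: "'a::topological_space measure"
  assumes coherent: "coherent_space TYPE('a)"
    and borel: "sets \<mu> = sets borel"
    and bounded: "emeasure \<mu> UNIV < \<infinity>"
    and nonzero: "emeasure \<mu> UNIV \<noteq> 0"
    and smooth: "tau_smooth \<mu>"
  shows "continuous_ival_valuation (ival_integral \<mu>)"
proof -
  have "emeasure \<mu> (space \<mu>) \<noteq> \<infinity>"
    using bounded sets_eq_imp_space_eq[OF borel] by auto
  then interpret finite_tau_smooth \<mu>
    by (simp add: finite_tau_smooth_def finite_tau_smooth_axioms_def finite_measureI borel smooth)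
  have lm: "(\<lambda>x. ilower (h x)) \<in> borel_measurable \<mu>"
    and um: "(\<lambda>x. iupper (h x)) \<in> borel_measurable \<mu>" if "h \<in> cont_maps" for h
    using cont_maps_lower_open[OF that] cont_maps_upper_open[OF that]
    by (auto intro: borel_measurable_lsc borel_measurable_usc)
  have ilower_I: "ilower (ival_integral \<mu> h) = (\<integral>\<^sup>+ x. ilower (h x) \<partial>\<mu>)" if "h \<in> cont_maps" for h
    by (simp add: ilower_ival_integral lower_integral_eq_nn_integral lm that)
  have mono: "ival_integral \<mu> h \<le> ival_integral \<mu> k"
    if "h \<in> cont_maps" "k \<in> cont_maps" "h \<le> k" for h k
    using that unfolding less_eq_ival_iff
    by (auto simp: ilower_I iupper_ival_integral le_fun_def less_eq_ival_iff
        intro!: nn_integral_mono upper_integral_mono um)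
  have "scott_continuous_on cont_maps (ival_integral \<mu>)"
    unfolding scott_continuous_on_def
  proof (intro conjI allI impI)
    show "mono_on cont_maps (ival_integral \<mu>)" using mono by (auto intro: mono_onI)
  next
    fix D and s :: "'a \<Rightarrow> ival"
    assume "D \<subseteq> cont_maps \<and> directed D \<and> is_lub_on cont_maps D s"
    then have D: "D \<subseteq> cont_maps" "directed D" and s: "is_lub_on cont_maps D s" by auto
    have s_cont: "s \<in> cont_maps" using s by (simp add: is_lub_on_def)
    have dir: "directed ((\<lambda>d. d x) ` D)" for x
      using D(2) by (rule directed_image_mono) (simp add: le_fun_def)
    \<comment> \<open>Suprema of continuous maps are pointwise, which splits the claim into a
      supremum of lower ends and an infimum of upper ends.\<close>
    note lub = is_lub_on_ival_bounds[OF dir cont_maps_lub_pointwise[OF D s]]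
    have sl: "ilower (s x) = (SUP d\<in>D. ilower (d x))"
      and su: "iupper (s x) = (INF d\<in>D. iupper (d x))" for x
      using lub[of x] by (simp_all add: image_image)
    have "ilower (ival_integral \<mu> s) = (SUP d\<in>D. \<integral>\<^sup>+ x. ilower (d x) \<partial>\<mu>)"
      unfolding ilower_I[OF s_cont] sl
      using D cont_maps_lower_open
      by (intro nn_integral_directed_SUP_lsc) (auto simp: le_fun_def less_eq_ival_iff)
    also have "\<dots> = (SUP d\<in>D. ilower (ival_integral \<mu> d))"
      using D(1) by (intro SUP_cong refl) (auto simp: ilower_I)
    finally have l: "ilower (ival_integral \<mu> s) = (SUP d\<in>D. ilower (ival_integral \<mu> d))" .
    have u: "iupper (ival_integral \<mu> s) = (INF d\<in>D. iupper (ival_integral \<mu> d))"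
      unfolding iupper_ival_integral su
      using D cont_maps_upper_open
      by (intro upper_integral_directed_INF) (auto simp: le_fun_def less_eq_ival_iff)
    show "is_lub_on UNIV (ival_integral \<mu> ` D) (ival_integral \<mu> s)"
      unfolding is_lub_on_def less_eq_ival_iff l u
      by (auto intro: SUP_upper INF_lower SUP_least INF_greatest)
  qed
  moreover have "ival_integral \<mu> (\<lambda>x. a * h x) = a * ival_integral \<mu> h" if h: "h \<in> cont_maps" for a h
  proof -
    \<comment> \<open>The lower product is that of \<open>ennreal\<close>, with
      \<open>0 * \<infinity> = 0\<close>, so scalars leave the Lebesgue integral as usual; the upper
      product is \<open>times_upper\<close>.\<close>
    have "ilower (i * j) = ilower i * ilower j" "iupper (i * j) = times_upper (iupper i) (iupper j)"
      for i j by (transfer; auto)+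
    then show ?thesis
      using lm[OF h] upper_integral_times_upper[OF nonzero cont_maps_upper_open[OF h]]
      by (simp add: ival_eq_iff ilower_ival_integral iupper_ival_integral
          lower_integral_eq_nn_integral nn_integral_cmult)
  qed
  moreover have "ival_integral \<mu> (\<lambda>x. h x + k x) = ival_integral \<mu> h + ival_integral \<mu> k"
    if h: "h \<in> cont_maps" and k: "k \<in> cont_maps" for h k
  proof -
    have "ilower (i + j) = ilower i + ilower j" "iupper (i + j) = iupper i + iupper j"
      for i j by (transfer; auto)+
    then show ?thesis
      using lm[OF h] lm[OF k] upper_integral_add[OF coherent um[OF h] um[OF k]]
      by (simp add: ival_eq_iff ilower_ival_integral iupper_ival_integral
          lower_integral_eq_nn_integral nn_integral_add)
  qed
  ultimately show ?thesis unfolding continuous_ival_valuation_def by blast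
qed

end
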